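(* Let $\mathbb{X}$ be a restriction category with restriction zeroes. For maps $f:A\to B$ and $g:A\to C$ define $f\perp_0g$ iff $\overline{f}g=0$ (equivalently $\overline{g}f=0$), and $f\perp_\delta g$ iff $f=0$ or $g=0$. Then: (i) $\perp_0$ is an interference relation, with associated restrictional interference relation given, for restriction idempotents $e,e'$ on the same object, by $e\perp_0e'$ iff $ee'=0$; (ii) $\perp_\delta$ is an interference relation, with associated restrictional interference relation given by $e\perp_\delta e'$ iff $e=0$ or $e'=0$. Furthermore, for every interference relation $\perp$ on $\mathbb{X}$, $\perp_\delta\subseteq\perp\subseteq\perp_0$.
   Context: Composition is diagrammatic: $fg$ means first $f$, then $g$. A restriction category is a category with an operator sending each $f:A\to B$ to $\overline{f}:A\to A$ such that $\overline{f}f=f$; $\overline{f}\,\overline{g}=\overline{g}\,\overline{f}$ and $\overline{\overline{g}f}=\overline{g}\,\overline{f}$ for $f:A\to B$, $g:A\to C$; and $f\overline{g}=\overline{fg}f$ for $f:A\to B$, $g:B\to C$. For parallel $f,g$: $f\le g$ iff $\overline{f}g=f$. A restriction idempotent is a map $e:A\to A$ with $\overline{e}=e$. Restriction zeroes: maps $0:A\to B$ with $f0=0=0f$ and $\overline{0}=0$. An interference relation $\perp$ is a family of relations between maps with the same domain ($f:A\to B$, $g:A\to C$) such that: $1_A\perp 0$; $f\perp g\Rightarrow g\perp f$; $f\perp f\Rightarrow f=0$; $f'\perp g'$, $f\le f'$, $g\le g'$ imply $f\perp g$; $f\perp g\Rightarrow hfk\perp hgk'$ for all composable $h,k,k'$;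 $f\perp g\Rightarrow\overline{f}\perp\overline{g}$. Its associated restrictional interference relation is its restriction to pairs of restriction idempotents on the same object. $\subseteq$ denotes inclusion of relations. *)

theory Defs
  imports Main
begin

text \<open>Composition is diagrammatic: \<open>f \<cdot> g\<close> is first \<open>f\<close>, then \<open>g\<close>. Outside the carriers \<open>obj\<close> and
  \<open>arr\<close> all operations are unconstrained.\<close>

record ('o, 'm) cat =
  obj :: "'o set"
  arr :: "'m set"
  src :: "'m \<Rightarrow> 'o"
  tgt :: "'m \<Rightarrow> 'o"
  comp :: "'m \<Rightarrow> 'm \<Rightarrow> 'm"  (infixl \<open>\<cdot>\<index>\<close> 70)
  ident :: "'o \<Rightarrow> 'm"  (\<open>\<one>\<index>\<close>)

definition hom :: "('o, 'm, 'x) cat_scheme \<Rightarrow> 'o \<Rightarrow> 'o \<Rightarrow> 'm set" where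
  "hom X A B = {f \<in> arr X. src X f = A \<and> tgt X f = B}"

locale category =
  fixes X :: "('o, 'm, 'x) cat_scheme" (structure)
  assumes src_obj: "f \<in> arr X \<Longrightarrow> src X f \<in> obj X"
    and tgt_obj: "f \<in> arr X \<Longrightarrow> tgt X f \<in> obj X"
    and ident_hom: "A \<in> obj X \<Longrightarrow> \<one> A \<in> hom X A A"
    and comp_hom: "\<lbrakk>f \<in> hom X A B; g \<in> hom X B C\<rbrakk> \<Longrightarrow> f \<cdot> g \<in> hom X A C"
    and ident_left: "f \<in> hom X A B \<Longrightarrow> \<one> A \<cdot> f = f"
    and ident_right: "f \<in> hom X A B \<Longrightarrow> f \<cdot> \<one> B = f"
    and comp_assoc: "\<lbrakk>f \<in> hom X A B; g \<in> hom X B C; h \<in> hom X C D\<rbrakk>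
      \<Longrightarrow> (f \<cdot> g) \<cdot> h = f \<cdot> (g \<cdot> h)"

record ('o, 'm) rcat = "('o, 'm) cat" +
  rst :: "'m \<Rightarrow> 'm"

locale restriction_category = category X
  for X :: "('o, 'm, 'x) rcat_scheme" (structure) +
  assumes rst_hom: "f \<in> hom X A B \<Longrightarrow> rst X f \<in> hom X A A"
    and rst_comp_self: "f \<in> hom X A B \<Longrightarrow> rst X f \<cdot> f = f"
    and rst_commute: "\<lbrakk>f \<in> hom X A B; g \<in> hom X A C\<rbrakk>
      \<Longrightarrow> rst X f \<cdot> rst X g = rst X g \<cdot> rst X f"
    and rst_rst_comp: "\<lbrakk>f \<in> hom X A B; g \<in> hom X A C\<rbrakk>
      \<Longrightarrow> rst X (rst X g \<cdot> f) = rst X g \<cdot> rst X f"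
    and comp_rst: "\<lbrakk>f \<in> hom X A B; g \<in> hom X B C\<rbrakk>
      \<Longrightarrow> f \<cdot> rst X g = rst X (f \<cdot> g) \<cdot> f"

definition rle :: "('o, 'm, 'x) rcat_scheme \<Rightarrow> 'm \<Rightarrow> 'm \<Rightarrow> bool" where
  "rle X f g \<longleftrightarrow> (\<exists>A B. f \<in> hom X A B \<and> g \<in> hom X A B) \<and> rst X f \<cdot>\<^bsub>X\<^esub> g = f"

definition ridem :: "('o, 'm, 'x) rcat_scheme \<Rightarrow> 'o \<Rightarrow> 'm set" where
  "ridem X A = {e \<in> hom X A A. rst X e = e}"

text \<open>The two-sided absorption laws determine the zero maps uniquely, so naming them in the structure
  is no extra choice.\<close>

record ('o, 'm) zrcat = "('o, 'm) rcat" +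
  zmap :: "'o \<Rightarrow> 'o \<Rightarrow> 'm"  (\<open>\<zero>\<index>\<close>)

locale restriction_category_zeroes = restriction_category X
  for X :: "('o, 'm, 'x) zrcat_scheme" (structure) +
  assumes zero_hom: "\<lbrakk>A \<in> obj X; B \<in> obj X\<rbrakk> \<Longrightarrow> \<zero> A B \<in> hom X A B"
    and comp_zero: "\<lbrakk>f \<in> hom X A B; C \<in> obj X\<rbrakk> \<Longrightarrow> f \<cdot> \<zero> B C = \<zero> A C"
    and zero_comp: "\<lbrakk>A \<in> obj X; f \<in> hom X B C\<rbrakk> \<Longrightarrow> \<zero> A B \<cdot> f = \<zero> A C"
    and rst_zero: "\<lbrakk>A \<in> obj X; B \<in> obj X\<rbrakk> \<Longrightarrow> rst X (\<zero> A B) = \<zero> A A"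

definition is_zero :: "('o, 'm, 'x) zrcat_scheme \<Rightarrow> 'm \<Rightarrow> bool" where
  "is_zero X f \<longleftrightarrow> f = \<zero>\<^bsub>X\<^esub> (src X f) (tgt X f)"

definition same_src_pairs :: "('o, 'm, 'x) cat_scheme \<Rightarrow> ('m \<times> 'm) set" where
  "same_src_pairs X = {(f, g). f \<in> arr X \<and> g \<in> arr X \<and> src X f = src X g}"

locale interference_relation = restriction_category_zeroes X
  for X :: "('o, 'm, 'x) zrcat_scheme" (structure) +
  fixes P :: "('m \<times> 'm) set"
  assumes same_src: "P \<subseteq> same_src_pairs X"
    and one_zero: "\<lbrakk>A \<in> obj X; B \<in> obj X\<rbrakk> \<Longrightarrow> (\<one> A, \<zero> A B) \<in> P"
    and symmetric: "(f, g) \<in> P \<Longrightarrow> (g, f) \<in> P"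
    and anti_reflexive: "(f, f) \<in> P \<Longrightarrow> is_zero X f"
    and down_closed: "\<lbrakk>(f', g') \<in> P; rle X f f'; rle X g g'\<rbrakk> \<Longrightarrow> (f, g) \<in> P"
    and comp_closed: "\<lbrakk>(f, g) \<in> P; f \<in> hom X A B; g \<in> hom X A C;
        h \<in> hom X A' A; k \<in> hom X B B'; k' \<in> hom X C C'\<rbrakk>
      \<Longrightarrow> (h \<cdot> f \<cdot> k, h \<cdot> g \<cdot> k') \<in> P"
    and rst_closed: "(f, g) \<in> P \<Longrightarrow> (rst X f, rst X g) \<in> P"

definition restrictional :: "('o, 'm, 'x) rcat_scheme \<Rightarrow> ('m \<times> 'm) set \<Rightarrow> ('m \<times> 'm) set" where
  "restrictional X P = P \<inter> (\<Union>A\<in>obj X. ridem X A \<times> ridem X A)"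

definition perp0 :: "('o, 'm, 'x) zrcat_scheme \<Rightarrow> ('m \<times> 'm) set" where
  "perp0 X = {(f, g) \<in> same_src_pairs X. is_zero X (rst X f \<cdot>\<^bsub>X\<^esub> g)}"

definition perp_delta :: "('o, 'm, 'x) zrcat_scheme \<Rightarrow> ('m \<times> 'm) set" where
  "perp_delta X = {(f, g) \<in> same_src_pairs X. is_zero X f \<or> is_zero X g}"

end

theory Submission
  imports Defs
begin

text \<open>In terms of restriction idempotents, \<open>f\<close> and \<open>g\<close> are related by \<open>perp0\<close> iff the product of
  their restrictions is zero, which is visibly symmetric and compatible with the order and with
  composition. For an arbitrary interference relation, precomposing with the product of the two
  restrictions turns a related pair into one related to itself, hence zero; and composing
  \<open>1 \<perp> 0\<close> with an arbitrary map relates that map to zero.\<close>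

lemma same_src_pairs_iff:
  "(f, g) \<in> same_src_pairs X \<longleftrightarrow> (\<exists>A B C. f \<in> hom X A B \<and> g \<in> hom X A C)"
  by (auto simp: same_src_pairs_def hom_def)

lemma is_zero_iff: "f \<in> hom X A B \<Longrightarrow> is_zero X f \<longleftrightarrow> f = \<zero>\<^bsub>X\<^esub> A B"
  by (auto simp: is_zero_def hom_def)

context category
begin

lemma hom_objD:
  assumes "f \<in> hom X A B"
  shows "A \<in> obj X" "B \<in> obj X"
  using assms src_obj tgt_obj by (auto simp: hom_def)

end

section \<open>Restrictions of identities and of restrictions\<close>

context restriction_category
begin

lemma rst_ident: "A \<in> obj X \<Longrightarrow> rst X (\<one> A) = \<one> A"
  using ident_right[OF rst_hom[OF ident_hom]] rst_comp_self[OF ident_hom] by simp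

lemma rst_idem: "f \<in> hom X A B \<Longrightarrow> rst X f \<cdot> rst X f = rst X f"
  using rst_rst_comp[of f A B f B] rst_comp_self[of f A B] by simp

text \<open>The law for the restriction of a composite \<open>rst X f \<cdot> g\<close>, taken at
  the identity of \<open>A\<close>, gives this because identities are their own
  restrictions.\<close>

lemma rst_rst:
  assumes f: "f \<in> hom X A B"
  shows "rst X (rst X f) = rst X f"
proof -
  have A: "A \<in> obj X" using f by (rule hom_objD)
  have "rst X (rst X f \<cdot> \<one> A) = rst X f \<cdot> rst X (\<one> A)"
    using rst_rst_comp[OF ident_hom[OF A] f] .
  then show ?thesis
    using ident_right[OF rst_hom[OF f]] rst_ident[OF A] by simp
qed

end

section \<open>The two extremal relations\<close>

context restriction_category_zeroes
begin

text \<open>Replaces \<open>is_zero\<close>, which reads the source and target off the map, by an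
  equation with an explicitly typed zero, so that later arguments are equational.\<close>

lemma perp0_iff:
  assumes "f \<in> hom X A B" "g \<in> hom X A C"
  shows "(f, g) \<in> perp0 X \<longleftrightarrow> rst X f \<cdot> g = \<zero> A C"
  using assms is_zero_iff[OF comp_hom[OF rst_hom]]
  by (auto simp: perp0_def same_src_pairs_iff)

lemma perp_delta_iff:
  assumes "f \<in> hom X A B" "g \<in> hom X A C"
  shows "(f, g) \<in> perp_delta X \<longleftrightarrow> f = \<zero> A B \<or> g = \<zero> A C"
  using assms is_zero_iff[OF assms(1)] is_zero_iff[OF assms(2)]
  by (auto simp: perp_delta_def same_src_pairs_iff)

text \<open>Left to right, take restrictions of both sides; right to left, compose with
  \<open>g\<close> and use \<open>rst X g \<cdot> g = g\<close>. The right-hand equation is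
  symmetric in \<open>f\<close> and \<open>g\<close> because restrictions commute, and this is the
  source of the symmetry of \<open>perp0\<close>.\<close>

lemma rst_comp_eq_zero_iff:
  assumes f: "f \<in> hom X A B" and g: "g \<in> hom X A C"
  shows "rst X f \<cdot> g = \<zero> A C \<longleftrightarrow> rst X f \<cdot> rst X g = \<zero> A A"
proof
  assume "rst X f \<cdot> g = \<zero> A C"
  then show "rst X f \<cdot> rst X g = \<zero> A A"
    using rst_rst_comp[OF g f] rst_zero[OF hom_objD[OF g]] by simp
next
  assume "rst X f \<cdot> rst X g = \<zero> A A"
  then show "rst X f \<cdot> g = \<zero> A C"
    using comp_assoc[OF rst_hom[OF f] rst_hom[OF g] g] rst_comp_self[OF g]
      zero_comp[OF hom_objD(1)[OF g] g] by metis
qed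

lemma rst_comp_eq_zero_commute:
  assumes "f \<in> hom X A B" "g \<in> hom X A C"
  shows "rst X f \<cdot> g = \<zero> A C \<longleftrightarrow> rst X g \<cdot> f = \<zero> A B"
  using rst_comp_eq_zero_iff[OF assms] rst_comp_eq_zero_iff[OF assms(2,1)] rst_commute[OF assms]
  by simp

lemma perp0_sym:
  assumes "(f, g) \<in> perp0 X"
  shows "(g, f) \<in> perp0 X"
proof -
  obtain A B C where f: "f \<in> hom X A B" and g: "g \<in> hom X A C"
    using assms by (auto simp: perp0_def same_src_pairs_iff)
  show ?thesis
    using assms perp0_iff[OF f g] perp0_iff[OF g f] rst_comp_eq_zero_commute[OF f g] by simp
qed

lemma perp0_comp_right:
  assumes "(f, g) \<in> perp0 X" and f: "f \<in> hom X A B" and g: "g \<in> hom X A C"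
    and k: "k \<in> hom X C D"
  shows "(f, g \<cdot> k) \<in> perp0 X"
proof -
  have "rst X f \<cdot> (g \<cdot> k) = \<zero> A C \<cdot> k"
    using assms comp_assoc[OF rst_hom[OF f] g k] by (simp add: perp0_iff)
  also have "\<dots> = \<zero> A D"
    using hom_objD(1)[OF f] k by (rule zero_comp)
  finally show ?thesis
    using perp0_iff[OF f comp_hom[OF g k]] by simp
qed

lemma perp0_comp_left:
  assumes "(f, g) \<in> perp0 X" and f: "f \<in> hom X A B" and g: "g \<in> hom X A C"
    and h: "h \<in> hom X D A"
  shows "(h \<cdot> f, h \<cdot> g) \<in> perp0 X"
proof -
  have "rst X (h \<cdot> f) \<cdot> (h \<cdot> g) = (rst X (h \<cdot> f) \<cdot> h) \<cdot> g"
    using comp_assoc[OF rst_hom[OF comp_hom[OF h f]] h g] by simp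
  \<comment> \<open>The axiom \<open>comp_rst\<close>, read from right to left, moves
    \<open>h\<close> to the front, where it meets the zero composite
    \<open>rst X f \<cdot> g\<close>.\<close>
  also have "\<dots> = (h \<cdot> rst X f) \<cdot> g"
    using comp_rst[OF h f] by simp
  also have "\<dots> = h \<cdot> (rst X f \<cdot> g)"
    using comp_assoc[OF h rst_hom[OF f] g] .
  also have "\<dots> = h \<cdot> \<zero> A C"
    using assms(1) perp0_iff[OF f g] by simp
  also have "\<dots> = \<zero> D C"
    using h hom_objD(2)[OF g] by (rule comp_zero)
  finally show ?thesis
    using perp0_iff[OF comp_hom[OF h f] comp_hom[OF h g]] by simp
qed

text \<open>Since \<open>g\<close> is \<open>rst X g \<cdot> g'\<close> and restrictions commute,
  \<open>rst X f \<cdot> g\<close> factors through \<open>rst X f \<cdot> g'\<close>, which is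
  zero.\<close>

lemma perp0_rle_right:
  assumes "(f, g') \<in> perp0 X" "rle X g g'"
  shows "(f, g) \<in> perp0 X"
proof -
  obtain A B C where f: "f \<in> hom X A B" and g': "g' \<in> hom X A C" and g: "g \<in> hom X A C"
    using assms by (fastforce simp: perp0_def rle_def same_src_pairs_def hom_def)
  have eq: "rst X g \<cdot> g' = g" using assms(2) by (simp add: rle_def)
  have "rst X f \<cdot> g = rst X f \<cdot> (rst X g \<cdot> g')" by (simp add: eq)
  also have "\<dots> = (rst X f \<cdot> rst X g) \<cdot> g'"
    using comp_assoc[OF rst_hom[OF f] rst_hom[OF g] g'] by simp
  also have "\<dots> = (rst X g \<cdot> rst X f) \<cdot> g'"
    using rst_commute[OF f g] by simp
  also have "\<dots> = rst X g \<cdot> (rst X f \<cdot> g')"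
    using comp_assoc[OF rst_hom[OF g] rst_hom[OF f] g'] .
  also have "\<dots> = \<zero> A C"
    using assms(1) perp0_iff[OF f g'] comp_zero[OF rst_hom[OF g] hom_objD(2)[OF g]] by simp
  finally show ?thesis using perp0_iff[OF f g] by simp
qed

text \<open>Closure under the order and under postcomposition is available for the second component;
  swapping the pair by symmetry transfers it to the first. Anti-reflexivity is the axiom
  \<open>rst X f \<cdot> f = f\<close>.\<close>

lemma interference_relation_perp0: "interference_relation X (perp0 X)"
proof
  show "perp0 X \<subseteq> same_src_pairs X"
    by (auto simp: perp0_def)
next
  fix A B assume A: "A \<in> obj X" and B: "B \<in> obj X"
  show "(\<one> A, \<zero> A B) \<in> perp0 X"
    using perp0_iff[OF ident_hom[OF A] zero_hom[OF A B]]
      comp_zero[OF rst_hom[OF ident_hom[OF A]] B] by simp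
next
  fix f g assume "(f, g) \<in> perp0 X"
  then show "(g, f) \<in> perp0 X" by (rule perp0_sym)
next
  fix f assume *: "(f, f) \<in> perp0 X"
  then obtain A B where f: "f \<in> hom X A B"
    by (auto simp: perp0_def same_src_pairs_iff)
  show "is_zero X f"
    using * perp0_iff[OF f f] rst_comp_self[OF f] is_zero_iff[OF f] by simp
next
  fix f' g' f g assume *: "(f', g') \<in> perp0 X" and f: "rle X f f'" and g: "rle X g g'"
  show "(f, g) \<in> perp0 X"
    by (rule perp0_sym[OF perp0_rle_right[OF perp0_sym[OF perp0_rle_right[OF * g]] f]])
next
  fix f g A B C h A' k B' k' C'
  assume *: "(f, g) \<in> perp0 X" and f: "f \<in> hom X A B" and g: "g \<in> hom X A C"
    and h: "h \<in> hom X A' A" and k: "k \<in> hom X B B'" and k': "k' \<in> hom X C C'"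
  have hf: "h \<cdot> f \<in> hom X A' B" and hg: "h \<cdot> g \<in> hom X A' C"
    using comp_hom h f g by blast+
  have "(h \<cdot> f, h \<cdot> g \<cdot> k') \<in> perp0 X"
    using perp0_comp_right[OF perp0_comp_left[OF * f g h] hf hg k'] .
  then show "(h \<cdot> f \<cdot> k, h \<cdot> g \<cdot> k') \<in> perp0 X"
    by (rule perp0_sym[OF perp0_comp_right[OF perp0_sym comp_hom[OF hg k'] hf k]])
next
  fix f g assume *: "(f, g) \<in> perp0 X"
  then obtain A B C where f: "f \<in> hom X A B" and g: "g \<in> hom X A C"
    by (auto simp: perp0_def same_src_pairs_iff)
  show "(rst X f, rst X g) \<in> perp0 X"
    using * perp0_iff[OF f g] rst_comp_eq_zero_iff[OF f g] rst_rst[OF f]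
      perp0_iff[OF rst_hom[OF f] rst_hom[OF g]] by simp
qed

text \<open>The closure conditions hold because zero maps are stable under passing to a smaller map,
  under composition on either side and under restriction.\<close>

lemma interference_relation_perp_delta: "interference_relation X (perp_delta X)"
proof
  show "perp_delta X \<subseteq> same_src_pairs X"
    by (auto simp: perp_delta_def)
next
  fix A B assume A: "A \<in> obj X" and B: "B \<in> obj X"
  show "(\<one> A, \<zero> A B) \<in> perp_delta X"
    using perp_delta_iff[OF ident_hom[OF A] zero_hom[OF A B]] by simp
next
  fix f g assume "(f, g) \<in> perp_delta X"
  then show "(g, f) \<in> perp_delta X"
    by (auto simp: perp_delta_def same_src_pairs_def)
next
  fix f assume "(f, f) \<in> perp_delta X"
  then show "is_zero X f" by (simp add: perp_delta_def)
next
  \<comment> \<open>If \<open>f'\<close> is zero, then \<open>f = rst X f \<cdot> f'\<close> is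
    absorbed by it.\<close>
  have zero_rle: "is_zero X f" if le: "rle X f f'" and "is_zero X f'" for f f'
  proof -
    obtain A B where f: "f \<in> hom X A B" and f': "f' \<in> hom X A B"
      using le by (auto simp: rle_def)
    show ?thesis
      using that comp_zero[OF rst_hom[OF f] hom_objD(2)[OF f]] is_zero_iff[OF f] is_zero_iff[OF f']
      by (simp add: rle_def)
  qed
  fix f' g' f g assume "(f', g') \<in> perp_delta X" "rle X f f'" "rle X g g'"
  then show "(f, g) \<in> perp_delta X"
    using zero_rle by (auto simp: perp_delta_def rle_def same_src_pairs_def hom_def)
next
  have zero: "h \<cdot> \<zero> A B \<cdot> k = \<zero> A' B'" if "h \<in> hom X A' A" "k \<in> hom X B B'" for A A' B B' h k
    using that comp_zero[OF that(1) hom_objD(1)[OF that(2)]]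
      zero_comp[OF hom_objD(1)[OF that(1)] that(2)] by simp
  fix f g A B C h A' k B' k' C'
  assume *: "(f, g) \<in> perp_delta X" and f: "f \<in> hom X A B" and g: "g \<in> hom X A C"
    and h: "h \<in> hom X A' A" and k: "k \<in> hom X B B'" and k': "k' \<in> hom X C C'"
  show "(h \<cdot> f \<cdot> k, h \<cdot> g \<cdot> k') \<in> perp_delta X"
    using * perp_delta_iff[OF f g] zero[OF h k] zero[OF h k']
      perp_delta_iff[OF comp_hom[OF comp_hom[OF h f] k] comp_hom[OF comp_hom[OF h g] k']]
    by auto
next
  fix f g assume *: "(f, g) \<in> perp_delta X"
  then obtain A B C where f: "f \<in> hom X A B" and g: "g \<in> hom X A C"
    by (auto simp: perp_delta_def same_src_pairs_iff)
  show "(rst X f, rst X g) \<in> perp_delta X"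
    using * perp_delta_iff[OF f g] perp_delta_iff[OF rst_hom[OF f] rst_hom[OF g]]
      rst_zero hom_objD[OF f] hom_objD[OF g] by auto
qed

end

section \<open>Bounds on an arbitrary interference relation\<close>

context interference_relation
begin

text \<open>The two components may be postcomposed with different maps: in
  \<open>1 \<perp> 0\<close> the identity is followed by \<open>f\<close>, while the zero map is
  followed by an identity.\<close>

lemma zero_related:
  assumes f: "f \<in> hom X A B" and C: "C \<in> obj X"
  shows "(f, \<zero> A C) \<in> P"
proof -
  have A: "A \<in> obj X" using f by (rule hom_objD)
  note 1 = ident_hom[OF A] and 0 = zero_hom[OF A C]
  have "(\<one> A \<cdot> \<one> A \<cdot> f, \<one> A \<cdot> \<zero> A C \<cdot> \<one> C) \<in> P"
    using comp_closed[OF one_zero[OF A C] 1 0 1 f ident_hom[OF C]] .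
  then show ?thesis
    using ident_left[OF 1] ident_left[OF f] ident_left[OF 0] ident_right[OF 0] by simp
qed

lemma perp_delta_subset: "perp_delta X \<subseteq> P"
proof (rule subrelI)
  fix f g assume *: "(f, g) \<in> perp_delta X"
  then obtain A B C where f: "f \<in> hom X A B" and g: "g \<in> hom X A C"
    by (auto simp: perp_delta_def same_src_pairs_iff)
  show "(f, g) \<in> P"
    using * perp_delta_iff[OF f g] zero_related[OF f hom_objD(2)[OF g]]
      symmetric[OF zero_related[OF g hom_objD(2)[OF f]]] by auto
qed

lemma subset_perp0: "P \<subseteq> perp0 X"
proof (rule subrelI)
  fix f g assume *: "(f, g) \<in> P"
  then obtain A B C where f: "f \<in> hom X A B" and g: "g \<in> hom X A C"
    using subsetD[OF same_src *] by (auto simp: same_src_pairs_iff)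
  note rf = rst_hom[OF f] and rg = rst_hom[OF g] and gf = comp_hom[OF rst_hom[OF g] rst_hom[OF f]]
  \<comment> \<open>Precomposing the related restrictions with \<open>rst X g\<close>, and
    postcomposing only the second with \<open>rst X f\<close>, makes both components equal to
    \<open>rst X g \<cdot> rst X f\<close>, by idempotence of \<open>rst X g\<close>.
    Anti-reflexivity then applies.\<close>
  have "(rst X g \<cdot> rst X f \<cdot> \<one> A, rst X g \<cdot> rst X g \<cdot> rst X f) \<in> P"
    using comp_closed[OF rst_closed[OF *] rf rg rg ident_hom[OF hom_objD(1)[OF f]] rf] .
  then have "(rst X g \<cdot> rst X f, rst X g \<cdot> rst X f) \<in> P"
    using ident_right[OF gf] rst_idem[OF g] by simp
  then have "rst X g \<cdot> rst X f = \<zero> A A"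
    using is_zero_iff[OF gf] by (blast dest: anti_reflexive)
  then show "(f, g) \<in> perp0 X"
    using perp0_iff[OF f g] rst_comp_eq_zero_iff[OF f g] rst_commute[OF f g] by simp
qed

end

theorem lemma3p6:
  fixes X :: "('o, 'm, 'x) zrcat_scheme"
  assumes "restriction_category_zeroes X"
  shows "(\<forall>A B C. \<forall>f\<in>hom X A B. \<forall>g\<in>hom X A C.
            rst X f \<cdot>\<^bsub>X\<^esub> g = \<zero>\<^bsub>X\<^esub> A C \<longleftrightarrow> rst X g \<cdot>\<^bsub>X\<^esub> f = \<zero>\<^bsub>X\<^esub> A B) \<and>
         interference_relation X (perp0 X) \<and>
         (\<forall>A\<in>obj X. \<forall>e\<in>ridem X A. \<forall>e'\<in>ridem X A.
            (e, e') \<in> restrictional X (perp0 X) \<longleftrightarrow> e \<cdot>\<^bsub>X\<^esub> e' = \<zero>\<^bsub>X\<^esub> A A) \<and>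
         interference_relation X (perp_delta X) \<and>
         (\<forall>A\<in>obj X. \<forall>e\<in>ridem X A. \<forall>e'\<in>ridem X A.
            (e, e') \<in> restrictional X (perp_delta X) \<longleftrightarrow>
              e = \<zero>\<^bsub>X\<^esub> A A \<or> e' = \<zero>\<^bsub>X\<^esub> A A) \<and>
         (\<forall>P. interference_relation X P \<longrightarrow> perp_delta X \<subseteq> P \<and> P \<subseteq> perp0 X)"
proof -
  interpret restriction_category_zeroes X by (rule assms)
  have "(e, e') \<in> restrictional X P \<longleftrightarrow> (e, e') \<in> P"
    if "A \<in> obj X" "e \<in> ridem X A" "e' \<in> ridem X A" for A e e' P
    using that by (auto simp: restrictional_def)
  \<comment> \<open>On restriction idempotents \<open>rst X e\<close> is \<open>e\<close> itself, so
    the typed characterizations specialize directly.\<close>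
  moreover have "(e, e') \<in> perp0 X \<longleftrightarrow> e \<cdot>\<^bsub>X\<^esub> e' = \<zero>\<^bsub>X\<^esub> A A"
    "(e, e') \<in> perp_delta X \<longleftrightarrow> e = \<zero>\<^bsub>X\<^esub> A A \<or> e' = \<zero>\<^bsub>X\<^esub> A A"
    if "e \<in> ridem X A" "e' \<in> ridem X A" for A e e'
    using that perp0_iff[of e A A e' A] perp_delta_iff[of e A A e' A] by (simp_all add: ridem_def)
  ultimately show ?thesis
    using interference_relation_perp0 interference_relation_perp_delta
      interference_relation.perp_delta_subset interference_relation.subset_perp0
    by (intro conjI ballI allI impI rst_comp_eq_zero_commute) simp_all
qed

end
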